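(* Let $s\ge 1$ and $t\ge 2$ be integers and let $G\in\mathcal{G}_{s,t}$ with root $r$ (the vertex of $K_1$). Then $$\eta(G,r)=\begin{cases} t+2s+4, & s \text{ even},\\ t+2s+3, & s \text{ odd.}\end{cases}$$
   Context: All graphs are finite, simple and connected. A configuration $C$ on a graph $G$ is a function $C:V(G)\to\mathbb{Z}_{\ge 0}$ ($C(v)$ is the number of pebbles on $v$); its size is $\sum_{v}C(v)$. A pebbling move removes two pebbles from a vertex and places one pebble on an adjacent vertex. The Two-Player Pebbling Game on $G$ with root $r$ and starting configuration $C$ is played by Mover and Defender in rounds: in each round Mover makes a pebbling move and then Defender makes a pebbling move; each player must take their turn. If Mover pebbles from $u$ to $v$, Defender may not pebble from $v$ to $u$ in the same round. Mover wins if at any time the root has at least one pebble; Defender wins if the root has no pebble and there are no more pebbling moves. A winning strategy for a player is a rule choosing that player's moves as a function of the current position which guarantees that player wins. The rooted two-player pebbling number $\eta(G,r)$ is the minimum $m$ such that for every configuration of $m$ pebbles Mover has a winning strategy; if for arbitrarily large $m$ there is a configuration of size greater than $m$ on which Defender has a winning strategy, then $\eta(G,r)=\infty$. For integers $s,t\ge1$, $\mathcal{G}_{s,t}$ is the class of all graphs $(K_1\cup \overline{K_t})\vee H$, where $H$ is any graph on $s$ vertices, $\overline{K_t}$ is the edgeless graph on $t$ vertices, $\cup$ is disjoint union and $\vee$ is the join (add all edges between the two graphs). The root $r$ is the vertex of $K_1$; $S=V(H)$ and $T=V(\overline{K_t})$. Thus $r$ is adjacent exactly to the vertices of $S$, each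 vertex of $T$ is adjacent exactly to the vertices of $S$, $T$ is independent, and $S$ induces $H$. *)

theory Defs
  imports "Graph_Theory.Graph_Theory" "HOL-Library.Extended_Nat"
begin

section \<open>Graphs\<close>

text \<open>
  A finite simple graph is a \<^locale>\<open>pair_graph\<close>: an edge \<open>uv\<close> is represented by the two arcs
  \<open>(u, v)\<close> and \<open>(v, u)\<close>.  The operations below are the usual ones on vertex-disjoint graphs;
  disjointness is required where they are used, in \<open>join_class\<close>.
\<close>

definition edgeless_graph :: "'a set \<Rightarrow> 'a pair_pre_digraph" where
  "edgeless_graph V = \<lparr> pverts = V, parcs = {} \<rparr>"

definition graph_union :: "'a pair_pre_digraph \<Rightarrow> 'a pair_pre_digraph \<Rightarrow> 'a pair_pre_digraph" where
  "graph_union G H = \<lparr> pverts = pverts G \<union> pverts H, parcs = parcs G \<union> parcs H \<rparr>"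

definition graph_join :: "'a pair_pre_digraph \<Rightarrow> 'a pair_pre_digraph \<Rightarrow> 'a pair_pre_digraph" where
  "graph_join G H = \<lparr> pverts = pverts G \<union> pverts H,
     parcs = parcs G \<union> parcs H \<union> pverts G \<times> pverts H \<union> pverts H \<times> pverts G \<rparr>"

text \<open>
  \<open>join_class s t G r\<close>: the graph \<open>G\<close> is of the form \<open>(K\<^sub>1 \<union> T) \<or> H\<close> with \<open>H\<close> an arbitrary (not
  necessarily connected) graph on \<open>s\<close> vertices, \<open>T\<close> edgeless on \<open>t\<close> vertices, and \<open>r\<close> the vertex
  of \<open>K\<^sub>1\<close>.  The parts may be any disjoint sets of the vertex type, so the class is closed under
  isomorphism.
\<close>

definition join_class :: "nat \<Rightarrow> nat \<Rightarrow> 'a pair_pre_digraph \<Rightarrow> 'a \<Rightarrow> bool" where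
  "join_class s t G r \<longleftrightarrow>
     (\<exists>T H. pair_graph H \<and> card (pverts H) = s \<and> finite T \<and> card T = t \<and>
        r \<notin> T \<and> r \<notin> pverts H \<and> T \<inter> pverts H = {} \<and>
        G = graph_join (graph_union (edgeless_graph {r}) (edgeless_graph T)) H)"


section \<open>The two-player pebbling game\<close>

type_synonym 'a config = "'a \<Rightarrow> nat"
type_synonym 'a move = "'a \<times> 'a"

text \<open>A configuration lives on the vertices of \<open>G\<close>; as a total function it vanishes elsewhere.\<close>

definition configs :: "'a pair_pre_digraph \<Rightarrow> 'a config set" where
  "configs G = {C. \<forall>v. v \<notin> pverts G \<longrightarrow> C v = 0}"

definition config_size :: "'a pair_pre_digraph \<Rightarrow> 'a config \<Rightarrow> nat" where
  "config_size G C = (\<Sum>v\<in>pverts G. C v)"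

definition pebbling_moves :: "'a pair_pre_digraph \<Rightarrow> 'a config \<Rightarrow> 'a move set" where
  "pebbling_moves G C = {(u, v). (u, v) \<in> parcs G \<and> C u \<ge> 2}"

fun apply_move :: "'a config \<Rightarrow> 'a move \<Rightarrow> 'a config" where
  "apply_move C (u, v) = C(u := C u - 2, v := C v + 1)"

datatype player = Mover | Defender

text \<open>
  A position when Defender is to move also records the move Mover has just made in this round,
  since Defender may not reverse it.
\<close>

datatype 'a position = MoverTurn "'a config" | DefenderTurn "'a config" "'a move"

fun position_config :: "'a position \<Rightarrow> 'a config" where
  "position_config (MoverTurn C) = C"
| "position_config (DefenderTurn C l) = C"

fun to_move :: "'a position \<Rightarrow> player" where
  "to_move (MoverTurn C) = Mover"
| "to_move (DefenderTurn C l) = Defender"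

fun legal_moves :: "'a pair_pre_digraph \<Rightarrow> 'a position \<Rightarrow> 'a move set" where
  "legal_moves G (MoverTurn C) = pebbling_moves G C"
| "legal_moves G (DefenderTurn C (u, v)) = pebbling_moves G C - {(v, u)}"

fun next_position :: "'a position \<Rightarrow> 'a move \<Rightarrow> 'a position" where
  "next_position (MoverTurn C) m = DefenderTurn (apply_move C m) m"
| "next_position (DefenderTurn C l) m = MoverTurn (apply_move C m)"

text \<open>
  "No more pebbling moves" is read as: the player to move has no legal move; in particular play also
  stops when Defender could only reverse Mover's last move.
\<close>

fun won_by :: "'a pair_pre_digraph \<Rightarrow> 'a \<Rightarrow> player \<Rightarrow> 'a position \<Rightarrow> bool" where
  "won_by G r Mover p \<longleftrightarrow> position_config p r \<ge> 1"
| "won_by G r Defender p \<longleftrightarrow> position_config p r = 0 \<and> legal_moves G p = {}"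

definition game_over :: "'a pair_pre_digraph \<Rightarrow> 'a \<Rightarrow> 'a position \<Rightarrow> bool" where
  "game_over G r p \<longleftrightarrow> (\<exists>P. won_by G r P p)"


section \<open>Strategies\<close>

type_synonym 'a strategy = "'a position \<Rightarrow> 'a move"

definition valid_strategy :: "'a pair_pre_digraph \<Rightarrow> 'a \<Rightarrow> player \<Rightarrow> 'a strategy \<Rightarrow> bool" where
  "valid_strategy G r P \<sigma> \<longleftrightarrow>
     (\<forall>p. to_move p = P \<and> \<not> game_over G r p \<longrightarrow> \<sigma> p \<in> legal_moves G p)"

text \<open>One turn of a play in which player \<open>P\<close> follows \<open>\<sigma>\<close> and the opponent moves arbitrarily.\<close>

definition play_step ::
  "'a pair_pre_digraph \<Rightarrow> 'a \<Rightarrow> player \<Rightarrow> 'a strategy \<Rightarrow> 'a position \<Rightarrow> 'a position \<Rightarrow> bool" where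
  "play_step G r P \<sigma> p q \<longleftrightarrow> \<not> game_over G r p \<and>
     (\<exists>m \<in> legal_moves G p. (to_move p = P \<longrightarrow> m = \<sigma> p) \<and> q = next_position p m)"

text \<open>
  Every turn removes one pebble, so every play ends (\<open>finite_plays\<close> below), and \<open>\<sigma>\<close> wins
  iff every position in which a play following \<open>\<sigma>\<close> can end is won by \<open>P\<close>.
\<close>

definition winning_strategy ::
  "'a pair_pre_digraph \<Rightarrow> 'a \<Rightarrow> player \<Rightarrow> 'a config \<Rightarrow> 'a strategy \<Rightarrow> bool" where
  "winning_strategy G r P C \<sigma> \<longleftrightarrow> valid_strategy G r P \<sigma> \<and>
     (\<forall>q. (play_step G r P \<sigma>)\<^sup>*\<^sup>* (MoverTurn C) q \<and> game_over G r q \<longrightarrow> won_by G r P q)"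

definition has_winning_strategy ::
  "'a pair_pre_digraph \<Rightarrow> 'a \<Rightarrow> player \<Rightarrow> 'a config \<Rightarrow> bool" where
  "has_winning_strategy G r P C \<longleftrightarrow> (\<exists>\<sigma>. winning_strategy G r P C \<sigma>)"


section \<open>The rooted two-player pebbling number\<close>

text \<open>The infimum of a nonempty set in \<^typ>\<open>enat\<close> is its minimum.\<close>

definition two_player_pebbling_number :: "'a pair_pre_digraph \<Rightarrow> 'a \<Rightarrow> enat" ("\<eta>") where
  "\<eta> G r =
     (if \<forall>m. \<exists>C \<in> configs G. config_size G C > m \<and> has_winning_strategy G r Defender C
      then \<infinity>
      else Inf {enat m | m. \<forall>C \<in> configs G. config_size G C = m \<longrightarrow> has_winning_strategy G r Mover C})"


section \<open>Sanity checks\<close>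

lemma join_class_pair_graph:
  assumes "join_class s t G r"
  shows "pair_graph G"
proof -
  obtain T H where H: "pair_graph H" and T: "finite T" and r: "r \<notin> T" "r \<notin> pverts H"
    and d: "T \<inter> pverts H = {}"
    and G: "G = graph_join (graph_union (edgeless_graph {r}) (edgeless_graph T)) H"
    using assms unfolding join_class_def by blast
  interpret H: pair_graph H by (rule H)
  have V: "pverts G = insert r T \<union> pverts H"
    and A: "parcs G = parcs H \<union> insert r T \<times> pverts H \<union> pverts H \<times> insert r T"
    unfolding G graph_join_def graph_union_def edgeless_graph_def by auto
  show ?thesis
  proof
    show "symmetric (with_proj G)"
      unfolding symmetric_def arcs_ends_def sym_def
      by (auto simp: A arc_to_ends_def dest: H.arcs_symmetric)
  qed (use T r d in \<open>auto simp: V A dest: H.arc_fst_in_verts H.arc_snd_in_verts H.pair_no_loops\<close>)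
qed

lemma join_class_connected:
  assumes "join_class s t G r" "s \<ge> 1"
  shows "connected (with_proj G)"
proof -
  obtain T H where H: "pair_graph H" and s: "card (pverts H) = s"
    and G: "G = graph_join (graph_union (edgeless_graph {r}) (edgeless_graph T)) H"
    using assms unfolding join_class_def by blast
  interpret H: pair_graph H by (rule H)
  have V: "pverts G = insert r T \<union> pverts H"
    and A: "parcs G = parcs H \<union> insert r T \<times> pverts H \<union> pverts H \<times> insert r T"
    unfolding G graph_join_def graph_union_def edgeless_graph_def by auto
  interpret G: pair_graph G by (rule join_class_pair_graph[OF assms(1)])
  obtain h where h: "h \<in> pverts H" using s assms(2) by fastforce
  have st: "u \<rightarrow>\<^sup>*\<^bsub>with_proj G\<^esub> v" if "(u, v) \<in> parcs G" for u v
    using that by (auto intro: G.reachable_adjI)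
  have rh: "x \<rightarrow>\<^sup>*\<^bsub>with_proj G\<^esub> r" "r \<rightarrow>\<^sup>*\<^bsub>with_proj G\<^esub> x" if x: "x \<in> pverts G" for x
  proof -
    have *: "x \<rightarrow>\<^sup>*\<^bsub>with_proj G\<^esub> r \<and> r \<rightarrow>\<^sup>*\<^bsub>with_proj G\<^esub> x"
    proof (cases "x \<in> pverts H")
      case True
      then show ?thesis by (intro conjI st) (auto simp: A)
    next
      case False
      then have "x \<in> insert r T" using x by (auto simp: V)
      then have "(x, h) \<in> parcs G" "(h, x) \<in> parcs G" "(h, r) \<in> parcs G" "(r, h) \<in> parcs G"
        using h by (auto simp: A)
      then show ?thesis using st G.reachable_trans by blast
    qed
    then show "x \<rightarrow>\<^sup>*\<^bsub>with_proj G\<^esub> r" "r \<rightarrow>\<^sup>*\<^bsub>with_proj G\<^esub> x" by auto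
  qed
  have "strongly_connected (with_proj G)"
    unfolding strongly_connected_def
  proof (intro conjI ballI)
    show "verts (with_proj G) \<noteq> {}" by (simp add: V)
  next
    fix u v assume "u \<in> verts (with_proj G)" "v \<in> verts (with_proj G)"
    then show "u \<rightarrow>\<^sup>*\<^bsub>with_proj G\<^esub> v"
      using G.reachable_trans[OF rh(1) rh(2)] by simp
  qed
  then show ?thesis 
    unfolding connected_def strongly_connected_def using G.reachable_mk_symmetricI by auto
qed

lemma finite_plays:
  assumes "pair_graph G"
  shows "wfP (\<lambda>q p. play_step G r P \<sigma> p q)"
proof -
  interpret pair_graph G by (rule assms)
  have dec: "config_size G (apply_move C m) < config_size G C" if m: "m \<in> pebbling_moves G C" for C m
  proof -
    obtain u v where uv: "m = (u, v)" by force
    have e: "(u, v) \<in> parcs G" "C u \<ge> 2" using m uv by (auto simp: pebbling_moves_def)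
    have V: "u \<in> pverts G" "v \<in> pverts G - {u}"
      using arc_fst_in_verts[OF e(1)] arc_snd_in_verts[OF e(1)] pair_no_loops[OF e(1)] by auto
    define W where "W = pverts G - {u} - {v}"
    have *: "config_size G D = D u + (D v + sum D W)" for D
      unfolding config_size_def W_def using V pair_finite_verts
      by (simp add: sum.remove[of "pverts G" u] sum.remove[of "pverts G - {u}" v])
    have "sum (apply_move C m) W = sum C W"
      unfolding W_def uv by (intro sum.cong) auto
    then show ?thesis using V e by (auto simp: * uv)
  qed
  show ?thesis
  proof (rule wfp_if_convertible_to_nat[where f = "\<lambda>p. config_size G (position_config p)"])
    fix q p assume "play_step G r P \<sigma> p q"
    then obtain m where m: "m \<in> legal_moves G p" "q = next_position p m"
      unfolding play_step_def by blast
    then show "config_size G (position_config q) < config_size G (position_config p)"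
      by (cases "(G, p)" rule: legal_moves.cases) (auto intro: dec)
  qed
qed

end

theory Submission
  imports Defs
begin

text \<open>
  As long as nobody has won, every vertex of \<open>S\<close> carries at most one pebble when Mover is to move, so
  Mover pebbles from \<open>T\<close> into \<open>S\<close>.  Let \<open>d\<close> be the number of empty vertices of \<open>S\<close> and \<open>N\<close> the sum
  of \<open>C w div 2\<close> over \<open>w \<in> T\<close>.  If Mover fills an empty vertex, Defender has to
  fill another one, which turns \<open>(d, N)\<close> into \<open>(d - 2, N - 2)\<close>; if Mover stacks a second pebble on a
  vertex, Defender has to move these two on, preferably to a vertex of \<open>T\<close>, at the price of
  \<open>d\<close> becoming \<open>d + 1\<close> and \<open>N\<close> becoming \<open>N - 1\<close> or, if the target was odd, \<open>N\<close>.  Hence Mover wins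
  by filling if \<open>d\<close> is odd and \<open>N \<ge> d + 1\<close>, and by filling until \<open>d = 0\<close> and then stacking if \<open>d\<close>
  is even and \<open>N \<ge> d + 3\<close>, or \<open>N \<ge> d + 2\<close> with all of \<open>T\<close> odd.  Defender wins if \<open>d\<close> is odd and
  \<open>N \<le> d\<close>, or \<open>d\<close> is even and \<open>N \<le> d + 1\<close>, or \<open>d\<close> is even and \<open>N = d + 2\<close> with an empty vertex in \<open>T\<close>
  that is kept for the answer to the first stacking.
\<close>

section \<open>Winning sets of configurations\<close>

lemma legal_moves_if_not_over:
  assumes "\<not> game_over G r p"
  shows "legal_moves G p \<noteq> {}"
proof
  assume "legal_moves G p = {}"
  then have "won_by G r (if position_config p r = 0 then Defender else Mover) p"
    by simp
  then show False using assms unfolding game_over_def by blast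
qed

text \<open>Playing the two strategies against each other yields a play that follows both. It ends
  because plays are finite, and its last position would have to be won by both players.\<close>

lemma not_both_winning:
  assumes "pair_graph G" and "has_winning_strategy G r Mover C"
  shows "\<not> has_winning_strategy G r Defender C"
proof
  assume "has_winning_strategy G r Defender C"
  then obtain \<tau> where \<tau>: "winning_strategy G r Defender C \<tau>"
    unfolding has_winning_strategy_def by blast
  obtain \<sigma> where \<sigma>: "winning_strategy G r Mover C \<sigma>"
    using assms(2) unfolding has_winning_strategy_def by blast
  have "False" if "(play_step G r Mover \<sigma>)\<^sup>*\<^sup>* (MoverTurn C) p"
    "(play_step G r Defender \<tau>)\<^sup>*\<^sup>* (MoverTurn C) p" for p
    using that
  proof (induction p rule: wfp_induct_rule[OF finite_plays[OF assms(1), of r Mover \<sigma>]])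
    case (1 p)
    have "\<not> game_over G r p"
    proof
      assume "game_over G r p"
      then have "won_by G r Mover p" "won_by G r Defender p"
        using 1(2,3) \<sigma> \<tau> unfolding winning_strategy_def by blast+
      then show False by simp
    qed
    moreover define m where "m = (if to_move p = Mover then \<sigma> p else \<tau> p)"
    ultimately have "m \<in> legal_moves G p"
      using \<sigma> \<tau> unfolding winning_strategy_def valid_strategy_def
      by (cases "to_move p") auto
    then have "play_step G r Mover \<sigma> p (next_position p m)"
      "play_step G r Defender \<tau> p (next_position p m)"
      using \<open>\<not> game_over G r p\<close> unfolding play_step_def m_def by (auto intro!: bexI)
    then show False using 1 by (meson rtranclp.rtrancl_into_rtrancl)
  qed
  then show False by blast
qed

text \<open>Closure is required over a whole round, so membership in \<open>W\<close> is an
  invariant at Mover's turns. The clause on nonempty \<open>legal_moves\<close> keeps the game from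
  ending in Defender's favour in the middle of a round.\<close>

lemma mover_wins_if_closed:
  assumes closed: "\<And>C. C \<in> W \<Longrightarrow> C r = 0 \<Longrightarrow> \<exists>m\<in>pebbling_moves G C.
      apply_move C m r \<ge> 1 \<or>
      legal_moves G (DefenderTurn (apply_move C m) m) \<noteq> {} \<and>
      (\<forall>m'\<in>legal_moves G (DefenderTurn (apply_move C m) m). apply_move (apply_move C m) m' \<in> W)"
    and "C \<in> W"
  shows "has_winning_strategy G r Mover C"
proof -
  define good where "good D m \<longleftrightarrow> D r \<ge> 1 \<or> legal_moves G (DefenderTurn D m) \<noteq> {} \<and>
      (\<forall>m'\<in>legal_moves G (DefenderTurn D m). apply_move D m' \<in> W)" for D m
  define inv where
    "inv p = (case p of MoverTurn D \<Rightarrow> D \<in> W | DefenderTurn D m \<Rightarrow> good D m)" for p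
  \<comment> \<open>\<open>valid_strategy\<close> demands legal moves also at positions outside
    \<open>W\<close>; there any legal move is taken.\<close>
  have "\<exists>m. (legal_moves G p \<noteq> {} \<longrightarrow> m \<in> legal_moves G p) \<and>
      (\<forall>D. p = MoverTurn D \<and> D \<in> W \<and> D r = 0 \<longrightarrow> good (apply_move D m) m)" for p
  proof (cases "\<exists>D. p = MoverTurn D \<and> D \<in> W \<and> D r = 0")
    case True
    then show ?thesis using closed unfolding good_def by fastforce
  next
    case False
    then show ?thesis by (metis all_not_in_conv)
  qed
  then obtain \<sigma> where \<sigma>: "\<And>p. legal_moves G p \<noteq> {} \<Longrightarrow> \<sigma> p \<in> legal_moves G p"
    "\<And>D. D \<in> W \<Longrightarrow> D r = 0 \<Longrightarrow> good (apply_move D (\<sigma> (MoverTurn D))) (\<sigma> (MoverTurn D))"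
    by metis
  have "inv q" if "(play_step G r Mover \<sigma>)\<^sup>*\<^sup>* (MoverTurn C) q" for q
    using that
  proof (induction rule: rtranclp_induct)
    case base
    then show ?case using assms(2) by (simp add: inv_def)
  next
    case (step p q)
    obtain m where m: "m \<in> legal_moves G p" "to_move p = Mover \<longrightarrow> m = \<sigma> p" "q = next_position p m"
      and over: "\<not> game_over G r p"
      using step.hyps(2) unfolding play_step_def by blast
    have "\<not> won_by G r Mover p" using over unfolding game_over_def by blast
    then have r: "position_config p r = 0" by simp
    show ?case
    proof (cases p)
      case (MoverTurn D)
      then show ?thesis using m r step.IH \<sigma>(2) by (simp add: inv_def)
    next
      case (DefenderTurn D l)
      then show ?thesis using m r step.IH by (auto simp: inv_def good_def)
    qed
  qed
  moreover have "won_by G r Mover q" if inv: "inv q" and over: "game_over G r q" for q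
  proof (rule ccontr)
    assume "\<not> won_by G r Mover q"
    moreover obtain P where "won_by G r P q" using over unfolding game_over_def by blast
    ultimately have "won_by G r Defender q" by (cases P) auto
    then have "position_config q r = 0" "legal_moves G q = {}" by simp_all
    then show False
      using inv closed by (cases q) (fastforce simp: inv_def good_def)+
  qed
  moreover have "valid_strategy G r Mover \<sigma>"
    unfolding valid_strategy_def by (intro allI impI \<sigma>(1) legal_moves_if_not_over[of G r]) simp
  ultimately show ?thesis
    unfolding has_winning_strategy_def winning_strategy_def by blast
qed

text \<open>The lower bound on \<open>\<eta>\<close> only needs that Mover has no winning strategy,
  so no strategy for Defender is built: against a given \<open>\<sigma>\<close>, suitable replies
  always lead on to another bad position, which contradicts finiteness of plays.\<close>

lemma mover_does_not_win_if_closed: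
  assumes "pair_graph G"
    and root: "\<And>C. C \<in> L \<Longrightarrow> C r = 0"
    and closed: "\<And>C m. C \<in> L \<Longrightarrow> m \<in> pebbling_moves G C \<Longrightarrow> apply_move C m r = 0 \<and>
      (legal_moves G (DefenderTurn (apply_move C m) m) = {} \<or>
       (\<exists>m'\<in>legal_moves G (DefenderTurn (apply_move C m) m). apply_move (apply_move C m) m' \<in> L))"
    and "C \<in> L"
  shows "\<not> has_winning_strategy G r Mover C"
proof
  assume "has_winning_strategy G r Mover C"
  then obtain \<sigma> where \<sigma>: "winning_strategy G r Mover C \<sigma>"
    unfolding has_winning_strategy_def by blast
  define bad where
    "bad p = (case p of MoverTurn D \<Rightarrow> D \<in> L
      | DefenderTurn D m \<Rightarrow> D r = 0 \<and> (legal_moves G (DefenderTurn D m) = {} \<or>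
          (\<exists>m'\<in>legal_moves G (DefenderTurn D m). apply_move D m' \<in> L)))" for p
  have "False" if "(play_step G r Mover \<sigma>)\<^sup>*\<^sup>* (MoverTurn C) p" "bad p" for p
    using that
  proof (induction p rule: wfp_induct_rule[OF finite_plays[OF assms(1), of r Mover \<sigma>]])
    case (1 p)
    have "position_config p r = 0"
      using 1(3) root by (cases p) (auto simp: bad_def)
    then have nw: "\<not> won_by G r Mover p" by simp
    then have over: "\<not> game_over G r p"
      using 1(2) \<sigma> unfolding winning_strategy_def by blast
    have "\<exists>q. play_step G r Mover \<sigma> p q \<and> bad q"
    proof (cases p)
      case (MoverTurn D)
      then have "\<sigma> p \<in> pebbling_moves G D"
        using \<sigma> over unfolding winning_strategy_def valid_strategy_def by force
      moreover have "play_step G r Mover \<sigma> p (next_position p (\<sigma> p))"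
        using calculation over MoverTurn unfolding play_step_def by auto
      ultimately show ?thesis
        using MoverTurn 1(3) closed[of D "\<sigma> p"]
        by (intro exI[of _ "next_position p (\<sigma> p)"]) (simp add: bad_def)
    next
      case (DefenderTurn D l)
      then obtain m where m: "m \<in> legal_moves G p" "apply_move D m \<in> L"
        using 1(3) legal_moves_if_not_over[OF over] by (auto simp: bad_def)
      have "play_step G r Mover \<sigma> p (next_position p m)"
        using m over DefenderTurn unfolding play_step_def by auto
      then show ?thesis using m DefenderTurn
        by (intro exI[of _ "next_position p m"]) (simp add: bad_def)
    qed
    then show False using 1 by (meson rtranclp.rtrancl_into_rtrancl)
  qed
  moreover have "bad (MoverTurn C)" using assms(4) by (simp add: bad_def)
  ultimately show False by blast
qed


section \<open>The game on a join\<close>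

text \<open>Of the graph \<open>H\<close> only its arc set \<open>A\<close> remains, known merely to
  lie inside \<open>S\<close> and to be loop-free.\<close>

locale rooted_join =
  fixes G :: "'a pair_pre_digraph" and r :: 'a and S T :: "'a set" and A :: "('a \<times> 'a) set"
  assumes graph: "pair_graph G"
    and fin: "finite S" "finite T"
    and disj: "r \<notin> S" "r \<notin> T" "S \<inter> T = {}"
    and verts: "pverts G = insert r (S \<union> T)"
    and arcs: "parcs G = A \<union> insert r T \<times> S \<union> S \<times> insert r T"
    and inner: "A \<subseteq> S \<times> S" "\<And>v. (v, v) \<notin> A"
begin

text \<open>This is \<open>d\<close> of the overview.\<close>

definition empties :: "'a config \<Rightarrow> nat" where
  "empties C = card {v \<in> S. C v = 0}"

text \<open>This is \<open>N\<close> of the overview: how many moves out of \<open>T\<close> are in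
  stock.\<close>

definition pairs :: "'a config \<Rightarrow> nat" where
  "pairs C = (\<Sum>w\<in>T. C w div 2)"

section \<open>How moves change the two counts\<close>

lemma pairs_pos_iff: "pairs C \<ge> 1 \<longleftrightarrow> (\<exists>w\<in>T. C w \<ge> 2)"
proof -
  have "pairs C = 0 \<longleftrightarrow> (\<forall>w\<in>T. C w div 2 = 0)" unfolding pairs_def using fin by simp
  then show ?thesis by (metis div_eq_0_iff less_one not_less zero_neq_numeral)
qed

lemma empties_pos_iff: "empties C \<ge> 1 \<longleftrightarrow> (\<exists>v\<in>S. C v = 0)"
  unfolding empties_def using fin by (auto simp: Suc_le_eq card_gt_0_iff)

lemma pairs_split: "w \<in> T \<Longrightarrow> pairs C = C w div 2 + (\<Sum>w\<in>T - {w}. C w div 2)"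
  unfolding pairs_def by (rule sum.remove[OF fin(2)])

lemma pairs_move_from_T:
  assumes "u \<in> T" "v \<in> S" "C u \<ge> 2"
  shows "pairs C = Suc (pairs (apply_move C (u, v)))"
proof -
  have "(\<Sum>w\<in>T - {u}. apply_move C (u, v) w div 2) = (\<Sum>w\<in>T - {u}. C w div 2)"
    using assms disj by (intro sum.cong) auto
  moreover have "apply_move C (u, v) u = C u - 2" using assms disj by auto
  ultimately show ?thesis
    using pairs_split[OF assms(1), of C] pairs_split[OF assms(1), of "apply_move C (u, v)"] assms(3)
    by (simp add: le_div_geq)
qed

lemma pairs_move_into_T:
  assumes "v \<in> S" "w \<in> T"
  shows "pairs (apply_move C (v, w)) = pairs C + (if odd (C w) then 1 else 0)"
proof -
  have "(\<Sum>x\<in>T - {w}. apply_move C (v, w) x div 2) = (\<Sum>x\<in>T - {w}. C x div 2)"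
    using assms disj by (intro sum.cong) auto
  moreover have "apply_move C (v, w) w = C w + 1" using assms disj by auto
  ultimately show ?thesis
    using pairs_split[OF assms(2), of C] pairs_split[OF assms(2), of "apply_move C (v, w)"]
    by (auto elim!: oddE evenE)
qed

lemma empties_fill:
  assumes "u \<in> T" "v \<in> S" "C v = 0"
  shows "empties C = Suc (empties (apply_move C (u, v)))"
proof -
  have "{x \<in> S. C x = 0} = insert v {x \<in> S. apply_move C (u, v) x = 0}"
    using assms disj by auto
  then show ?thesis unfolding empties_def using fin by simp
qed

lemma empties_stack:
  assumes "u \<in> T" "v \<in> S" "C v \<noteq> 0"
  shows "empties (apply_move C (u, v)) = empties C"
proof -
  have "{x \<in> S. apply_move C (u, v) x = 0} = {x \<in> S. C x = 0}"
    using assms disj by auto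
  then show ?thesis unfolding empties_def by simp
qed

lemma empties_move_into_T:
  assumes "v \<in> S" "w \<in> T" "C v = 2"
  shows "empties (apply_move C (v, w)) = Suc (empties C)"
proof -
  have "{x \<in> S. apply_move C (v, w) x = 0} = insert v {x \<in> S. C x = 0}"
    using assms disj by auto
  then show ?thesis unfolding empties_def using fin assms by simp
qed

text \<open>Only vertices of \<open>T\<close> can hold two pebbles here, and their neighbours all
  lie in \<open>S\<close>.\<close>

lemma move_from_T:
  assumes "(x, y) \<in> pebbling_moves G C" "C r = 0" "\<forall>v\<in>S. C v \<le> 1"
  shows "x \<in> T" "y \<in> S" "C x \<ge> 2"
proof -
  have "x \<notin> S" "x \<noteq> r" using assms unfolding pebbling_moves_def by fastforce+
  then show "x \<in> T" "y \<in> S" "C x \<ge> 2"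
    using assms(1) inner unfolding pebbling_moves_def arcs by auto
qed

section \<open>The two invariant sets, and Mover's moves\<close>

text \<open>The first two disjuncts are games won already or on the next move; they absorb
  Defender's losing replies.\<close>

definition mover_set :: "'a config set" where
  "mover_set = {C. C r \<ge> 1 \<or> (\<exists>v\<in>S. C v \<ge> 2) \<or>
     odd (empties C) \<and> pairs C \<ge> empties C + 1 \<or>
     even (empties C) \<and>
       (pairs C \<ge> empties C + 3 \<or> pairs C \<ge> empties C + 2 \<and> (\<forall>w\<in>T. odd (C w)))}"

text \<open>This is smaller than the complement of \<open>mover_set\<close>: with
  \<open>empties C\<close> even and \<open>pairs C = empties C + 2\<close>, it leaves out the case
  where \<open>T\<close> has an even vertex but no empty one.\<close>

definition defender_set :: "'a config set" where
  "defender_set = {C. C r = 0 \<and> (\<forall>v\<in>S. C v \<le> 1) \<and>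
     (odd (empties C) \<and> pairs C \<le> empties C \<or>
      even (empties C) \<and>
        (pairs C \<le> empties C + 1 \<or> pairs C \<le> empties C + 2 \<and> (\<exists>w\<in>T. C w = 0)))}"

text \<open>Defender's reply also comes out of \<open>T\<close>. Either it stacks and loses, or it
  fills, and then both counts have dropped by 2 while the parities on \<open>T\<close> are
  unchanged.\<close>

lemma mover_fill:
  assumes C: "C \<in> mover_set" "C r = 0" "\<forall>v\<in>S. C v \<le> 1" and "empties C \<ge> 1"
  shows "\<exists>m\<in>pebbling_moves G C. legal_moves G (DefenderTurn (apply_move C m) m) \<noteq> {} \<and>
      (\<forall>m'\<in>legal_moves G (DefenderTurn (apply_move C m) m).
         apply_move (apply_move C m) m' \<in> mover_set)"
proof -
  have cond: "odd (empties C) \<and> pairs C \<ge> empties C + 1 \<or>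
     even (empties C) \<and>
       (pairs C \<ge> empties C + 3 \<or> pairs C \<ge> empties C + 2 \<and> (\<forall>w\<in>T. odd (C w)))"
    using C unfolding mover_set_def by fastforce
  obtain v where v: "v \<in> S" "C v = 0" using assms(4) empties_pos_iff by auto
  obtain u where u: "u \<in> T" "C u \<ge> 2" using cond pairs_pos_iff[of C] by auto
  have m: "(u, v) \<in> pebbling_moves G C"
    using u v unfolding pebbling_moves_def arcs by auto
  define D where "D = apply_move C (u, v)"
  have D: "D r = 0" "\<forall>x\<in>S. D x \<le> 1" "empties C = Suc (empties D)" "pairs C = Suc (pairs D)"
    using C u v disj empties_fill[where C = C, OF u(1) v] pairs_move_from_T[where C = C, OF u(1) v(1) u(2)]
    unfolding D_def by auto
  have parD: "odd (D w) = odd (C w)" if "w \<in> T" for w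
    using that u v disj unfolding D_def by auto
  \<comment> \<open>Defender must still have a move, since a stuck Defender wins.\<close>
  have "pairs D \<ge> 1" using cond D assms(4) by auto
  then obtain u' where u': "u' \<in> T" "D u' \<ge> 2" using pairs_pos_iff by auto
  have "(u', v) \<in> legal_moves G (DefenderTurn D (u, v))"
    using u' v u disj by (auto simp: pebbling_moves_def arcs)
  moreover have "apply_move D m' \<in> mover_set"
    if m': "m' \<in> legal_moves G (DefenderTurn D (u, v))" for m'
  proof -
    obtain x y where xy: "m' = (x, y)" by force
    then have "(x, y) \<in> pebbling_moves G D" using m' by auto
    note x = move_from_T[OF this D(1,2)]
    show ?thesis
    proof (cases "D y = 0")
      case False
      then have "apply_move D m' y \<ge> 2" using xy x disj by auto
      then show ?thesis unfolding mover_set_def using x by blast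
    next
      case True
      have "empties D = Suc (empties (apply_move D m'))" "pairs D = Suc (pairs (apply_move D m'))"
        using empties_fill[where C = D, OF x(1,2) True] pairs_move_from_T[where C = D, OF x] xy by auto
      moreover have "odd (apply_move D m' w) = odd (C w)" if "w \<in> T" for w
        using that x disj parD[OF that] unfolding xy by auto
      ultimately show ?thesis using cond D unfolding mover_set_def by auto
    qed
  qed
  ultimately show ?thesis using m unfolding D_def by blast
qed

text \<open>The two pebbles on \<open>v\<close> threaten the root. The only reply that does not lose
  on the spot moves them to a vertex of \<open>T\<close>, which leaves one empty vertex in
  \<open>S\<close> and at least two pairs, the odd case of \<open>mover_set\<close>.\<close>

lemma mover_stack:
  assumes C: "C \<in> mover_set" "C r = 0" "\<forall>v\<in>S. C v \<le> 1" and "empties C = 0" and "S \<noteq> {}"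
  shows "\<exists>m\<in>pebbling_moves G C. legal_moves G (DefenderTurn (apply_move C m) m) \<noteq> {} \<and>
      (\<forall>m'\<in>legal_moves G (DefenderTurn (apply_move C m) m).
         apply_move (apply_move C m) m' \<in> mover_set)"
proof -
  have cond: "pairs C \<ge> 3 \<or> pairs C \<ge> 2 \<and> (\<forall>w\<in>T. odd (C w))"
    using C assms(4) unfolding mover_set_def by fastforce
  have full: "C x = 1" if "x \<in> S" for x
    using that C(3) assms(4) empties_pos_iff[of C] by (metis le_neq_implies_less less_one not_one_le_zero)
  obtain v where v: "v \<in> S" using assms(5) by blast
  obtain u where u: "u \<in> T" "C u \<ge> 2" using cond pairs_pos_iff[of C] by auto
  have uv: "u \<noteq> v" "r \<noteq> u" "r \<noteq> v" using u v disj by auto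
  have m: "(u, v) \<in> pebbling_moves G C"
    using u v unfolding pebbling_moves_def arcs by auto
  define D where "D = apply_move C (u, v)"
  have D: "D v = 2" "empties D = 0" "pairs C = Suc (pairs D)"
    using full[OF v] u v assms(4) empties_stack[where C = C, OF u(1) v] pairs_move_from_T[where C = C, OF u(1) v u(2)]
    unfolding D_def by auto
  have "(v, r) \<in> legal_moves G (DefenderTurn D (u, v))"
    using D v uv by (auto simp: pebbling_moves_def arcs)
  moreover have "apply_move D m' \<in> mover_set"
    if m': "m' \<in> legal_moves G (DefenderTurn D (u, v))" for m'
  proof -
    obtain x y where xy: "m' = (x, y)" by force
    have e: "(x, y) \<in> parcs G" "(x, y) \<noteq> (v, u)" 
      using m' xy by (auto simp: pebbling_moves_def)
    show ?thesis
    proof (cases "x = v")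
      case False
      then have "apply_move D m' v \<ge> 2" using xy D by auto
      then show ?thesis unfolding mover_set_def using v by blast
    next
      case True
      then consider "y = r" | "y \<in> S" "y \<noteq> v" | "y \<in> T" "y \<noteq> u"
        using e v inner disj unfolding arcs by auto
      then show ?thesis
      proof cases
        case 1
        then have "apply_move D m' r \<ge> 1" using xy by auto
        then show ?thesis unfolding mover_set_def by blast
      next
        case 2
        then have "apply_move D m' y = 2"
          using xy full[OF 2(1)] u disj unfolding D_def by auto
        then show ?thesis unfolding mover_set_def using 2 by force
      next
        case 3
        \<comment> \<open>As \<open>y\<close> is not the source \<open>u\<close>, it is still odd in
          the all-odd case, so the arriving pebble restores the pair just spent.\<close>
        then have "D y = C y" using v disj unfolding D_def by auto
        then have "empties (apply_move D m') = 1" "pairs (apply_move D m') \<ge> 2"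
          using D cond 3 empties_move_into_T[where C = D, OF v 3(1) D(1)] pairs_move_into_T[OF v 3(1), of D] xy True
          by auto
        then show ?thesis unfolding mover_set_def by auto
      qed
    qed
  qed
  ultimately show ?thesis using m unfolding D_def by blast
qed

lemma mover_wins:
  assumes "S \<noteq> {}" and "C \<in> mover_set"
  shows "has_winning_strategy G r Mover C"
proof (rule mover_wins_if_closed[OF _ assms(2)])
  fix C assume C: "C \<in> mover_set" "C r = 0"
  show "\<exists>m\<in>pebbling_moves G C. apply_move C m r \<ge> 1 \<or>
      legal_moves G (DefenderTurn (apply_move C m) m) \<noteq> {} \<and>
      (\<forall>m'\<in>legal_moves G (DefenderTurn (apply_move C m) m).
         apply_move (apply_move C m) m' \<in> mover_set)"
  proof (cases "\<exists>v\<in>S. C v \<ge> 2")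
    case True
    then obtain v where v: "v \<in> S" "C v \<ge> 2" by blast
    then have "(v, r) \<in> pebbling_moves G C" "apply_move C (v, r) r \<ge> 1"
      unfolding pebbling_moves_def arcs by auto
    then show ?thesis by blast
  next
    case False
    then have le: "\<forall>v\<in>S. C v \<le> 1" by fastforce
    show ?thesis
    proof (cases "empties C = 0")
      case True
      then show ?thesis using mover_stack[OF C le _ assms(1)] by blast
    next
      case False
      then show ?thesis using mover_fill[OF C le] by (meson less_one not_le)
    qed
  qed
qed

section \<open>Defender's replies\<close>

text \<open>Answering a fill by a fill lowers both counts by 2, and an empty vertex of
  \<open>T\<close> stays empty because pebbles only leave \<open>T\<close>.\<close>

lemma defender_fill:
  assumes C: "C \<in> defender_set" and m: "(x, y) \<in> pebbling_moves G C" and "C y = 0"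
    and D_def: "D = apply_move C (x, y)"
  shows "legal_moves G (DefenderTurn D (x, y)) = {} \<or>
    (\<exists>m'\<in>legal_moves G (DefenderTurn D (x, y)). apply_move D m' \<in> defender_set)"
proof (cases "legal_moves G (DefenderTurn D (x, y)) = {}")
  case False
  have le: "C r = 0" "\<forall>v\<in>S. C v \<le> 1" using C unfolding defender_set_def by auto
  note x = move_from_T[OF m le]
  have D: "D r = 0" "\<forall>v\<in>S. D v \<le> 1" "empties C = Suc (empties D)" "pairs C = Suc (pairs D)"
    using le x assms(3) disj empties_fill[where C = C, OF x(1,2) assms(3)] pairs_move_from_T[where C = C, OF x]
    unfolding D_def by auto
  have keep: "C w = 0 \<Longrightarrow> w \<in> T \<Longrightarrow> D w = 0" for w
    using x disj unfolding D_def by auto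
  obtain x' y' where "(x', y') \<in> pebbling_moves G D" using False by auto
  note x' = move_from_T[OF this D(1,2)]
  then have "pairs D \<ge> 1" using pairs_pos_iff by blast
  \<comment> \<open>A positive even \<open>empties C\<close> is at least 2; an odd one is at least
    \<open>pairs C\<close>, hence at least 2.\<close>
  then have "empties D \<ge> 1" using C D unfolding defender_set_def by (auto elim!: oddE evenE)
  then obtain z where z: "z \<in> S" "D z = 0" using empties_pos_iff by blast
  define F where "F = apply_move D (x', z)"
  have "empties D = Suc (empties F)" "pairs D = Suc (pairs F)"
    using empties_fill[where C = D, OF x'(1) z] pairs_move_from_T[where C = D, OF x'(1) z(1) x'(3)] unfolding F_def by auto
  moreover have "F r = 0" "\<forall>v\<in>S. F v \<le> 1"
    using D x' z disj unfolding F_def by auto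
  moreover have "C w = 0 \<Longrightarrow> w \<in> T \<Longrightarrow> F w = 0" for w
    using keep[of w] z disj unfolding F_def by auto
  ultimately have "F \<in> defender_set" using C D unfolding defender_set_def by auto
  moreover have "(x', z) \<in> legal_moves G (DefenderTurn D (x, y))"
    using x' x z disj by (auto simp: pebbling_moves_def arcs)
  ultimately show ?thesis unfolding F_def by blast
qed simp

text \<open>Moving the stack back to \<open>T\<close> flips the parity of \<open>empties\<close>,
  and the bounds for the two parities are matched to this. Since returning to \<open>x\<close> is
  forbidden, a second vertex of \<open>T\<close> is required.\<close>

lemma defender_unstack:
  assumes C: "C \<in> defender_set" and m: "(x, y) \<in> pebbling_moves G C" and "C y \<noteq> 0"
    and D_def: "D = apply_move C (x, y)" and T: "card T \<ge> 2"
  shows "\<exists>m'\<in>legal_moves G (DefenderTurn D (x, y)). apply_move D m' \<in> defender_set"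
proof -
  have le: "C r = 0" "\<forall>v\<in>S. C v \<le> 1" using C unfolding defender_set_def by auto
  note x = move_from_T[OF m le]
  have "x \<noteq> y" "r \<noteq> x" "r \<noteq> y" using x disj by auto
  have "C y = 1" using x(2) le(2) assms(3) by (metis le_antisym less_one not_le)
  then have D: "D y = 2" "D r = 0" "empties D = empties C" "pairs C = Suc (pairs D)"
    using le x disj empties_stack[where C = C, OF x(1,2) assms(3)] pairs_move_from_T[where C = C, OF x]
    unfolding D_def by auto
  have "T - {x} \<noteq> {}"
    using T fin card_mono[of "{x}" T] by auto
  \<comment> \<open>An empty vertex differs from \<open>x\<close> automatically. Being even, it
    gains no pair, which is vital when \<open>pairs C = empties C + 2\<close>.\<close>
  then obtain w where w: "w \<in> T" "w \<noteq> x" "(\<exists>w\<in>T. C w = 0) \<Longrightarrow> C w = 0"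
    using x by (cases "\<exists>w\<in>T. C w = 0") fastforce+
  define F where "F = apply_move D (y, w)"
  have "D w = C w" using w x disj unfolding D_def by auto
  then have "empties F = Suc (empties C)"
    "pairs C \<le> Suc (pairs F)" "pairs F \<le> pairs C"
    "\<forall>w\<in>T. C w = 0 \<longrightarrow> pairs C = Suc (pairs F)"
    using D w empties_move_into_T[where C = D, OF x(2) w(1) D(1)] pairs_move_into_T[OF x(2) w(1), of D]
    unfolding F_def by auto
  moreover have "F r = 0" "\<forall>v\<in>S. F v \<le> 1"
    using D le x w disj unfolding F_def D_def by auto
  ultimately have "F \<in> defender_set" using C unfolding defender_set_def by auto
  moreover have "(y, w) \<in> legal_moves G (DefenderTurn D (x, y))"
    using x w D by (auto simp: pebbling_moves_def arcs)
  ultimately show ?thesis unfolding F_def by blast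
qed

lemma mover_does_not_win:
  assumes "card T \<ge> 2" and "C \<in> defender_set"
  shows "\<not> has_winning_strategy G r Mover C"
proof (rule mover_does_not_win_if_closed[OF graph _ _ assms(2)])
  fix C m assume C: "C \<in> defender_set" and m: "m \<in> pebbling_moves G C"
  obtain x y where xy: "m = (x, y)" by force
  have le: "C r = 0" "\<forall>v\<in>S. C v \<le> 1" using C unfolding defender_set_def by auto
  note x = move_from_T[OF m[unfolded xy] le]
  have "apply_move C m r = 0" using le x disj unfolding xy by auto
  then show "apply_move C m r = 0 \<and> (legal_moves G (DefenderTurn (apply_move C m) m) = {} \<or>
       (\<exists>m'\<in>legal_moves G (DefenderTurn (apply_move C m) m).
          apply_move (apply_move C m) m' \<in> defender_set))"
    using defender_fill[OF C m[unfolded xy] _ refl]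
      defender_unstack[OF C m[unfolded xy] _ refl assms(1)] xy by blast
qed (simp add: defender_set_def)


section \<open>Sizes of configurations\<close>

lemma config_size_eq: "config_size G C = C r + (sum C S + sum C T)"
  unfolding config_size_def verts using fin disj by (simp add: sum.union_disjoint)

lemma sum_S_le: "\<forall>v\<in>S. C v \<le> 1 \<Longrightarrow> sum C S + empties C = card S"
proof -
  assume le: "\<forall>v\<in>S. C v \<le> 1"
  have "empties C = (\<Sum>v\<in>S. if C v = 0 then 1 else 0)"
    unfolding empties_def using fin by (simp add: sum.If_cases Int_def)
  then have "sum C S + empties C = (\<Sum>v\<in>S. C v + (if C v = 0 then 1 else 0))"
    by (simp add: sum.distrib)
  also have "\<dots> = (\<Sum>v\<in>S. 1)" using le by (intro sum.cong) (auto simp: le_Suc_eq)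
  finally show ?thesis by simp
qed

lemma sum_T_le: "sum C T \<le> 2 * pairs C + card T"
  and sum_T_less: "w \<in> T \<Longrightarrow> even (C w) \<Longrightarrow> sum C T < 2 * pairs C + card T"
proof -
  have eq: "sum C T = 2 * pairs C + (\<Sum>w\<in>T. C w mod 2)"
    unfolding pairs_def by (simp add: sum_distrib_left flip: sum.distrib)
  have "(\<Sum>w\<in>T. C w mod 2) \<le> (\<Sum>w\<in>T. 1)" by (intro sum_mono) simp
  then show "sum C T \<le> 2 * pairs C + card T" using eq by simp
  assume w: "w \<in> T" "even (C w)"
  have "(\<Sum>w\<in>T. C w mod 2) < (\<Sum>w\<in>T. 1)"
    using fin w by (intro sum_strict_mono_ex1) (auto intro!: bexI[of _ w])
  then show "sum C T < 2 * pairs C + card T" using eq by simp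
qed

text \<open>If no win is immediate, \<open>S\<close> carries \<open>card S - empties C\<close>
  pebbles, so \<open>2 * pairs C\<close> is at least \<open>card S + empties C\<close> plus 4 or 3.
  The critical case is \<open>empties C\<close> even, where this gives
  \<open>pairs C \<ge> empties C + 2\<close>; an even vertex in \<open>T\<close> makes the estimate
  strict and yields one more pair.\<close>

lemma large_in_mover_set:
  assumes "config_size G C \<ge> card T + 2 * card S + (if even (card S) then 4 else 3)"
  shows "C \<in> mover_set"
proof (cases "C r \<ge> 1 \<or> (\<exists>v\<in>S. C v \<ge> 2)")
  case True
  then show ?thesis unfolding mover_set_def by blast
next
  case False
  then have "C r = 0" "\<forall>v\<in>S. C v \<le> 1" by fastforce+
  then have size: "sum C S + sum C T \<ge> card T + 2 * card S + (if even (card S) then 4 else 3)"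
    and S: "sum C S + empties C = card S"
    using assms config_size_eq sum_S_le by auto
  \<comment> \<open>When \<open>card S\<close> and \<open>empties C\<close> differ in parity, they
    differ by at least 1; this offsets the smaller constant 3 for odd \<open>card S\<close>.\<close>
  have par: "even (card S) \<longleftrightarrow> (even (sum C S) \<longleftrightarrow> even (empties C))"
    unfolding S[symmetric] by auto
  show ?thesis
  proof (cases "odd (empties C)")
    case True
    then have "pairs C \<ge> empties C + 1"
      using size S par sum_T_le[of C] by (auto split: if_splits elim!: oddE)
    then show ?thesis using True unfolding mover_set_def by blast
  next
    case even: False
    show ?thesis
    proof (cases "\<forall>w\<in>T. odd (C w)")
      case True
      have "pairs C \<ge> empties C + 2"
        using even size S par sum_T_le[of C] by (auto split: if_splits elim!: oddE)
      then show ?thesis using True even unfolding mover_set_def by blast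
    next
      case False
      then have "sum C T < 2 * pairs C + card T" using sum_T_less by blast
      then have "pairs C \<ge> empties C + 3"
        using even size S par by (auto split: if_splits elim!: oddE)
      then show ?thesis using even unfolding mover_set_def by blast
    qed
  qed
qed

text \<open>Leave \<open>w0\<close> empty, pile up to \<open>2 * q + 1\<close> pebbles on
  \<open>w1\<close>, and put single pebbles, which form no pair, on the rest. This holds at most
  \<open>2 * q + 1 + (card T - 2)\<close> pebbles.\<close>

lemma small_T_config:
  assumes "m \<le> 2 * q + card T - 1" and "card T \<ge> 2"
  obtains c :: "'a config" and w
  where "sum c T = m" "pairs c \<le> q" "w \<in> T" "c w = 0"
proof -
  obtain X where "X \<subseteq> T" "card X = 2" using assms(2) by (meson obtain_subset_with_card_n)
  then obtain w0 w1 where w: "w0 \<in> T" "w1 \<in> T" "w0 \<noteq> w1"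
    by (metis card_2_iff insert_subset)
  have "card (T - {w0, w1}) = card T - 2" using w fin by (simp add: card_Diff_subset)
  \<comment> \<open>Truncated subtraction: for small \<open>m\<close> no single pebbles are
    placed.\<close>
  then have "m - (2 * q + 1) \<le> card (T - {w0, w1})" using assms by simp
  then obtain B where B: "B \<subseteq> T - {w0, w1}" "card B = m - (2 * q + 1)"
    by (meson obtain_subset_with_card_n)
  define c where "c v = (if v = w1 then min m (2 * q + 1) else if v \<in> B then 1 else 0)" for v
  have split: "sum f T = f w1 + sum f (T - {w1})" for f :: "'a \<Rightarrow> nat"
    by (rule sum.remove[OF fin(2) w(2)])
  have "sum c (T - {w1}) = (\<Sum>v\<in>T - {w1}. if v \<in> B then 1 else 0)"
    unfolding c_def by (intro sum.cong) auto
  also have "\<dots> = card ((T - {w1}) \<inter> B)"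
    using fin by (simp add: sum.If_cases)
  also have "(T - {w1}) \<inter> B = B" using B by auto
  finally have "sum c T = m" using B split[of c] by (simp add: c_def)
  moreover have "(\<Sum>v\<in>T - {w1}. c v div 2) = 0" by (auto simp: c_def)
  then have "pairs c \<le> q" unfolding pairs_def using split[of "\<lambda>v. c v div 2"] by (simp add: c_def)
  moreover have "c w0 = 0" using w B by (auto simp: c_def)
  ultimately show ?thesis using that w by blast
qed

text \<open>Every smaller size is treated, since \<open>\<eta>\<close> is an infimum over all sizes
  that always favour Mover.\<close>

lemma small_defender_config:
  assumes "card T \<ge> 2" and "S \<noteq> {}"
    and "m < card T + 2 * card S + (if even (card S) then 4 else 3)"
  shows "\<exists>C\<in>configs G \<inter> defender_set. config_size G C = m"
proof -
  \<comment> \<open>One pebble in \<open>S\<close>, if available, makes the number of empty vertices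
    even when \<open>card S\<close> is odd.\<close>
  define B :: "'a set" where
    "B = (if even (card S) \<or> m = 0 then {} else {SOME v. v \<in> S})"
  have B: "B \<subseteq> S" "card B \<le> m" "finite B"
    "card B = (if even (card S) \<or> m = 0 then 0 else 1)"
    unfolding B_def using assms(2) by (auto simp: some_in_eq)
  \<comment> \<open>The most pairs \<open>defender_set\<close> allows for even
    \<open>empties\<close> with an empty vertex in \<open>T\<close>. The capacity is then
    \<open>2 * q + card T - 1 + card B\<close>, one below the threshold when \<open>B\<close> has
    its intended size.\<close>
  define q where "q = card S - card B + 2"
  have le: "card B \<le> card S" using B(1) fin by (simp add: card_mono)
  have "m - card B \<le> 2 * q + card T - 1"
    using assms(1,3) B(4) le unfolding q_def by (auto split: if_splits)
  then obtain c w where c: "sum c T = m - card B" "pairs c \<le> q" "w \<in> T" "c w = 0"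
    using small_T_config[OF _ assms(1)] by blast
  define C where "C v = (if v \<in> T then c v else if v \<in> B then 1 else 0)" for v
  have "sum C T = sum c T" "pairs C = pairs c"
    unfolding C_def pairs_def by (auto intro: sum.cong)
  moreover have S: "\<And>v. v \<in> S \<Longrightarrow> C v = (if v \<in> B then 1 else 0)"
    unfolding C_def using disj by auto
  then have "sum C S = card B"
    using B(1,3) fin by (simp add: sum.If_cases Int_absorb1)
  moreover have le1: "C r = 0" "\<forall>v\<in>S. C v \<le> 1"
    using B disj S by (auto simp: C_def)
  moreover have "sum C S + empties C = card S" by (rule sum_S_le[OF le1(2)])
  ultimately have "config_size G C = m" "empties C = card S - card B" "pairs C \<le> q"
    using c B by (auto simp: config_size_eq)
  moreover have "C \<in> configs G"
    using B(1) by (auto simp: configs_def verts C_def)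
  moreover have "C \<in> defender_set"
  proof (cases "even (empties C)")
    case True
    moreover have "C w = 0" using c by (simp add: C_def)
    ultimately show ?thesis
      using le1 c(3) \<open>pairs C \<le> q\<close> \<open>empties C = _\<close> unfolding defender_set_def q_def by auto
  next
    case False
    \<comment> \<open>The exception in \<open>B\<close>: without pebbles the odd case holds
      trivially.\<close>
    then have "m = 0" using \<open>empties C = _\<close> B(4) le by (auto split: if_splits)
    then have "pairs C = 0" 
      using \<open>sum C T = sum c T\<close> c(1) fin by (simp add: pairs_def)
    then show ?thesis using le1 False unfolding defender_set_def by auto
  qed
  ultimately show ?thesis by blast
qed

lemma two_player_pebbling_number_eq:
  assumes "S \<noteq> {}" and "card T \<ge> 2"
  shows "\<eta> G r = enat (card T + 2 * card S + (if even (card S) then 4 else 3))"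
    (is "_ = enat ?m")
proof -
  have win: "has_winning_strategy G r Mover C" if "config_size G C \<ge> ?m" for C
    using that large_in_mover_set mover_wins[OF assms(1)] by blast
  \<comment> \<open>Mover wins from every size at least \<open>?m\<close>, so Defender cannot win
    from arbitrarily large configurations and \<open>\<eta>\<close> is given by the infimum.\<close>
  then have fin: "\<not> (\<forall>m. \<exists>C \<in> configs G. config_size G C > m \<and> has_winning_strategy G r Defender C)"
    using not_both_winning[OF graph] by (meson less_imp_le)
  have "?m \<le> m" if "\<forall>C \<in> configs G. config_size G C = m \<longrightarrow> has_winning_strategy G r Mover C" for m
    using that small_defender_config[OF assms(2,1), of m] mover_does_not_win[OF assms(2)]
    by (meson IntD1 IntD2 not_le)
  then have "Inf {enat m | m. \<forall>C \<in> configs G. config_size G C = m \<longrightarrow> has_winning_strategy G r Mover C}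
      = enat ?m"
    by (intro antisym Inf_lower Inf_greatest) (use win in auto)
  then show ?thesis unfolding two_player_pebbling_number_def using fin by (simp only: if_False)
qed

end

lemma rooted_join_if_join_class:
  assumes "join_class s t G r"
  obtains S T A where "rooted_join G r S T A" "card S = s" "card T = t"
proof -
  obtain T H where H: "pair_graph H" "card (pverts H) = s" and T: "finite T" "card T = t"
    and r: "r \<notin> T" "r \<notin> pverts H" and d: "T \<inter> pverts H = {}"
    and G: "G = graph_join (graph_union (edgeless_graph {r}) (edgeless_graph T)) H"
    using assms unfolding join_class_def by blast
  interpret H: pair_graph H by (rule H)
  have "rooted_join G r (pverts H) T (parcs H)"
  proof (rule rooted_join.intro)
    show "pair_graph G" by (rule join_class_pair_graph[OF assms])
    show "parcs H \<subseteq> pverts H \<times> pverts H"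
      by (auto dest: H.arc_fst_in_verts H.arc_snd_in_verts)
    show "\<And>v. (v, v) \<notin> parcs H" by (auto dest: H.pair_no_loops)
  qed (use T r d in \<open>auto simp: G graph_join_def graph_union_def edgeless_graph_def\<close>)
  then show ?thesis by (rule that[OF _ H(2) T(2)])
qed

theorem theorem3p21:
  fixes s t :: nat and G :: "'a pair_pre_digraph" and r :: 'a
  assumes "s \<ge> 1" and "t \<ge> 2"
    and "join_class s t G r"
  shows "\<eta> G r = (if even s then enat (t + 2 * s + 4) else enat (t + 2 * s + 3))"
proof -
  obtain S T A where J: "rooted_join G r S T A" and card: "card S = s" "card T = t"
    using rooted_join_if_join_class[OF assms(3)] by blast
  have "S \<noteq> {}" "card T \<ge> 2" using card assms by auto
  from rooted_join.two_player_pebbling_number_eq[OF J this] show ?thesis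
    using card by simp
qed

end
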